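(* Consider a finite POMDP with log-linear transition and observation models, bounded features, bounded-away-from-zero initial distribution $\nu_0$, true parameter $\Theta^\star=(\theta^\star,w^\star)$ and feasible radius $r_\Theta>0$ (all as specified in the context), and assume that the uniform Dobrushin coefficients satisfy $\kappa_P,\kappa_\Phi\in(0,1]$ and $$\alpha:=(1-\kappa_P)(4-3\kappa_\Phi)<1.$$ Let $\Theta=(\theta,w)$ satisfy $\|\Theta-\Theta^\star\|_2\le r_\Theta$, and put $\delta(\theta):=\|\theta-\theta^\star\|_2$, $\delta(w):=\|w-w^\star\|_2$. Fix $t\ge 1$ and an action sequence $(a_0,\dots,a_{t-1})\in\mathbb A^t$, and let $(b_k^\Theta)_{k=0}^t$ and $(b_k^{\Theta^\star})_{k=0}^t$ be the belief processes computed under $\Theta$ and $\Theta^\star$ on the same observations and actions, with the same prior $b_0^\Theta=b_0^{\Theta^\star}=\nu_0$. Then the map $\Theta\mapsto b_t^\Theta$ is Lipschitz at $\Theta^\star$ in expectation; namely, for every $t\ge 1$, $$\mathbb E\Big[\|b_t^\Theta-b_t^{\Theta^\star}\|_{\mathrm{TV}}\Big]\le \frac{1-\alpha^t}{1-\alpha}\,c_b(\delta(\theta),\delta(w)),\qquad c_b(\delta(\theta),\delta(w)):=B\Big(\delta(w)+\frac{3-2\kappa_\Phi}{2}\,\delta(\theta)\Big),$$ where the expectation is over $\hat s_{1:t}\sim P_{\Theta^\star}(\cdot\mid a_{0:t-1})$.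
   Context: $\mathbb S$ (latent states), $\hat{\mathbb S}$ (observations), $\mathbb A$ (actions) are finite nonempty sets; $\Delta_X$ is the set of probability vectors on a finite set $X$; $\|\mu-\nu\|_{\mathrm{TV}}=\frac12\|\mu-\nu\|_1$. Log-linear model: for $\theta\in\mathbb R^{d_\theta}$, $w\in\mathbb R^{d_w}$, $$P_\theta(s'\mid s,a)=\frac{\exp\{\theta^\top\phi_p(s,a,s')\}}{\sum_{\bar s\in\mathbb S}\exp\{\theta^\top\phi_p(s,a,\bar s)\}},\qquad \Phi_w(\hat s\mid s)=\frac{\exp\{w^\top\phi_\Phi(s,\hat s)\}}{\sum_{\bar s\in\hat{\mathbb S}}\exp\{w^\top\phi_\Phi(s,\bar s)\}},$$ with feature maps satisfying $\sup_{s,a,s'}\|\phi_p(s,a,s')\|_2\le B$ and $\sup_{s,\hat s}\|\phi_\Phi(s,\hat s)\|_2\le B$ for some $B<\infty$. The initial state distribution $\nu_0\in\Delta_{\mathbb S}$ is known and satisfies $1>\nu_{\max}\ge\nu_0(s)\ge\nu_{\min}>0$ for all $s$. Realizability: the data-generating POMDP has transition kernel $P_{\theta^\star}$ and observation model $\Phi_{w^\star}$, with $\Theta^\star=(\theta^\star,w^\star)$. The feasible set is $\{\Theta:\|\Theta-\Theta^\star\|_2\le r_\Theta\}$, where $\|\Theta-\Theta^\star\|_2^2=\|\theta-\theta^\star\|_2^2+\|w-w^\star\|_2^2$. Uniform Dobrushin coefficients (infima over feasible parameters $(\theta,w)$): $$\kappa_P:=\inf_\theta\inf_{s,s',a}\sum_{x\in\mathbb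 S}\min\{P_\theta(x\mid s,a),P_\theta(x\mid s',a)\},\qquad \kappa_\Phi:=\inf_w\inf_{s,s'}\sum_{\hat s\in\hat{\mathbb S}}\min\{\Phi_w(\hat s\mid s),\Phi_w(\hat s\mid s')\}.$$ Belief process: $b_0^\Theta=\nu_0$ and, given actions $a_k$ and observations $\hat s_{k+1}$, $$b_{k+1}^\Theta(s')=\frac{\Phi_w(\hat s_{k+1}\mid s')\sum_{s}P_\theta(s'\mid s,a_k)b_k^\Theta(s)}{\sum_{\bar s}\Phi_w(\hat s_{k+1}\mid\bar s)\sum_sP_\theta(\bar s\mid s,a_k)b_k^\Theta(s)}.$$ $P_{\Theta^\star}(\cdot\mid a_{0:t-1})$ is the law of the observations when $s_0\sim\nu_0$, $s_{k+1}\sim P_{\theta^\star}(\cdot\mid s_k,a_k)$, $\hat s_k\sim\Phi_{w^\star}(\cdot\mid s_k)$ for $k\ge1$, with the given fixed actions. *)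

theory Defs
  imports "HOL-Probability.Probability"
begin

text \<open>
  Latent states, observations and actions are finite types \<open>'s\<close>, \<open>'o\<close>, \<open>'a\<close>.  The parameter
  \<open>\<Theta> = (\<theta>, w)\<close> lives in a product space, whose library norm is
  \<open>sqrt ((norm \<theta>)\<^sup>2 + (norm w)\<^sup>2)\<close>.
\<close>

type_synonym ('s, 'a, 'p) trans_feature = "'s \<Rightarrow> 'a \<Rightarrow> 's \<Rightarrow> real ^ 'p"
type_synonym ('s, 'o, 'q) obs_feature = "'s \<Rightarrow> 'o \<Rightarrow> real ^ 'q"

definition trans_prob ::
  "('s::finite, 'a, 'p::finite) trans_feature \<Rightarrow> real ^ 'p \<Rightarrow> 's \<Rightarrow> 'a \<Rightarrow> 's \<Rightarrow> real" where
  "trans_prob \<phi>p \<theta> s a s' =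
     exp (\<theta> \<bullet> \<phi>p s a s') / (\<Sum>x\<in>UNIV. exp (\<theta> \<bullet> \<phi>p s a x))"

definition obs_prob ::
  "('s, 'o::finite, 'q::finite) obs_feature \<Rightarrow> real ^ 'q \<Rightarrow> 's \<Rightarrow> 'o \<Rightarrow> real" where
  "obs_prob \<phi>o w s y = exp (w \<bullet> \<phi>o s y) / (\<Sum>x\<in>UNIV. exp (w \<bullet> \<phi>o s x))"

definition trans_pmf ::
  "('s::finite, 'a, 'p::finite) trans_feature \<Rightarrow> real ^ 'p \<Rightarrow> 's \<Rightarrow> 'a \<Rightarrow> 's pmf" where
  "trans_pmf \<phi>p \<theta> s a = embed_pmf (trans_prob \<phi>p \<theta> s a)"

definition obs_pmf ::
  "('s, 'o::finite, 'q::finite) obs_feature \<Rightarrow> real ^ 'q \<Rightarrow> 's \<Rightarrow> 'o pmf" where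
  "obs_pmf \<phi>o w s = embed_pmf (obs_prob \<phi>o w s)"

lemma pmf_embed_softmax:
  fixes f :: "'b::finite \<Rightarrow> real"
  shows "pmf (embed_pmf (\<lambda>x. exp (f x) / (\<Sum>z\<in>UNIV. exp (f z)))) y
         = exp (f y) / (\<Sum>z\<in>UNIV. exp (f z))"
proof (rule pmf_embed_pmf)
  have pos: "0 < (\<Sum>z\<in>UNIV. exp (f z))"
    by (rule sum_pos) auto
  show nn: "0 \<le> exp (f x) / (\<Sum>z\<in>UNIV. exp (f z))" for x
    using pos by simp
  have "(\<integral>\<^sup>+x. ennreal (exp (f x) / (\<Sum>z\<in>UNIV. exp (f z))) \<partial>count_space UNIV)
        = ennreal (\<Sum>x\<in>UNIV. exp (f x) / (\<Sum>z\<in>UNIV. exp (f z)))"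
    using nn by (simp add: nn_integral_count_space_finite sum_ennreal)
  also have "(\<Sum>x\<in>UNIV. exp (f x) / (\<Sum>z\<in>UNIV. exp (f z))) = 1"
    using pos by (simp flip: sum_divide_distrib)
  finally show "(\<integral>\<^sup>+x. ennreal (exp (f x) / (\<Sum>z\<in>UNIV. exp (f z))) \<partial>count_space UNIV) = 1"
    by simp
qed

text \<open>The two \<^const>\<open>embed_pmf\<close> applications above are well-defined.\<close>

lemma pmf_trans_pmf: "pmf (trans_pmf \<phi>p \<theta> s a) s' = trans_prob \<phi>p \<theta> s a s'"
  unfolding trans_pmf_def trans_prob_def by (rule pmf_embed_softmax)

lemma pmf_obs_pmf: "pmf (obs_pmf \<phi>o w s) y = obs_prob \<phi>o w s y"
  unfolding obs_pmf_def obs_prob_def by (rule pmf_embed_softmax)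

text \<open>
  Joint law of the current state \<open>s\<^sub>k\<close> and the observation history under fixed actions.  There is
  no observation at time 0, so position \<open>i\<close> of the history holds the observation made at
  time \<open>i + 1\<close>.
\<close>

primrec state_obs_law ::
  "('s::finite, 'a, 'p::finite) trans_feature \<Rightarrow> ('s, 'o::finite, 'q::finite) obs_feature \<Rightarrow>
   's pmf \<Rightarrow> real ^ 'p \<Rightarrow> real ^ 'q \<Rightarrow> (nat \<Rightarrow> 'a) \<Rightarrow> nat \<Rightarrow> ('s \<times> 'o list) pmf" where
  "state_obs_law \<phi>p \<phi>o \<nu>0 \<theta> w a 0 = map_pmf (\<lambda>s. (s, [])) \<nu>0"
| "state_obs_law \<phi>p \<phi>o \<nu>0 \<theta> w a (Suc k) =
     bind_pmf (state_obs_law \<phi>p \<phi>o \<nu>0 \<theta> w a k) (\<lambda>(s, ys).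
       bind_pmf (trans_pmf \<phi>p \<theta> s (a k)) (\<lambda>s'.
         map_pmf (\<lambda>y. (s', ys @ [y])) (obs_pmf \<phi>o w s')))"

definition obs_law ::
  "('s::finite, 'a, 'p::finite) trans_feature \<Rightarrow> ('s, 'o::finite, 'q::finite) obs_feature \<Rightarrow>
   's pmf \<Rightarrow> real ^ 'p \<Rightarrow> real ^ 'q \<Rightarrow> (nat \<Rightarrow> 'a) \<Rightarrow> nat \<Rightarrow> 'o list pmf" where
  "obs_law \<phi>p \<phi>o \<nu>0 \<theta> w a t = map_pmf snd (state_obs_law \<phi>p \<phi>o \<nu>0 \<theta> w a t)"

text \<open>With the above indexing, \<open>ys ! k\<close> is the observation used to form the belief at \<open>k + 1\<close>.\<close>

primrec belief ::
  "('s::finite, 'a, 'p::finite) trans_feature \<Rightarrow> ('s, 'o::finite, 'q::finite) obs_feature \<Rightarrow>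
   's pmf \<Rightarrow> real ^ 'p \<Rightarrow> real ^ 'q \<Rightarrow> (nat \<Rightarrow> 'a) \<Rightarrow> 'o list \<Rightarrow> nat \<Rightarrow> 's \<Rightarrow> real" where
  "belief \<phi>p \<phi>o \<nu>0 \<theta> w a ys 0 = pmf \<nu>0"
| "belief \<phi>p \<phi>o \<nu>0 \<theta> w a ys (Suc k) = (\<lambda>s'.
     obs_prob \<phi>o w s' (ys ! k) *
       (\<Sum>s\<in>UNIV. trans_prob \<phi>p \<theta> s (a k) s' * belief \<phi>p \<phi>o \<nu>0 \<theta> w a ys k s) /
     (\<Sum>x\<in>UNIV. obs_prob \<phi>o w x (ys ! k) *
       (\<Sum>s\<in>UNIV. trans_prob \<phi>p \<theta> s (a k) x * belief \<phi>p \<phi>o \<nu>0 \<theta> w a ys k s)))"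

definition tv_dist :: "('s::finite \<Rightarrow> real) \<Rightarrow> ('s \<Rightarrow> real) \<Rightarrow> real" where
  "tv_dist \<mu> \<nu> = (1 / 2) * (\<Sum>s\<in>UNIV. \<bar>\<mu> s - \<nu> s\<bar>)"

definition feasible ::
  "real ^ 'p::finite \<Rightarrow> real ^ 'q::finite \<Rightarrow> real \<Rightarrow> ((real ^ 'p) \<times> (real ^ 'q)) set" where
  "feasible \<theta>s ws r = {\<Theta>. norm (\<Theta> - (\<theta>s, ws)) \<le> r}"

definition kappa_P ::
  "('s::finite, 'a::finite, 'p::finite) trans_feature \<Rightarrow> ((real ^ 'p) \<times> (real ^ 'q::finite)) set \<Rightarrow> real"
  where
  "kappa_P \<phi>p F = (INF (\<theta>, w)\<in>F. INF (s, s', a)\<in>UNIV.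
     \<Sum>x\<in>UNIV. min (trans_prob \<phi>p \<theta> s a x) (trans_prob \<phi>p \<theta> s' a x))"

definition kappa_Phi ::
  "('s::finite, 'o::finite, 'q::finite) obs_feature \<Rightarrow> ((real ^ 'p::finite) \<times> (real ^ 'q)) set \<Rightarrow> real"
  where
  "kappa_Phi \<phi>o F = (INF (\<theta>, w)\<in>F. INF (s, s')\<in>UNIV.
     \<Sum>y\<in>UNIV. min (obs_prob \<phi>o w s y) (obs_prob \<phi>o w s' y))"

definition c_b :: "real \<Rightarrow> real \<Rightarrow> real \<Rightarrow> real \<Rightarrow> real" where
  "c_b B \<kappa>Phi \<delta>\<theta> \<delta>w = B * (\<delta>w + (3 - 2 * \<kappa>Phi) / 2 * \<delta>\<theta>)"

end

theory Submission
  imports Defs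
begin

text \<open>
  One filtering step predicts, \<open>p = K b\<close>, and then conditions on the new observation by Bayes' rule.
  Compare the step of the filter with parameter \<open>\<Theta>\<close>, started at \<open>b\<close>, with the step of
  the true filter, started at \<open>b*\<close>.  Write \<open>K\<close> for the transition kernel at
  \<open>\<theta>\<close> and \<open>K*\<close>, \<open>L*\<close> for the true kernels, and \<open>TV\<close> for total variation.

  \<^item> Prediction.  \<open>TV(K b, K* b*) \<le> TV(K b, K b*) + TV(K b*, K* b*)\<close>.  The first term contracts
    by Dobrushin's factor \<open>1 - \<kappa>P\<close> (\<open>tv_dist_push_contraction\<close>); the second is the
    change of a log-linear model, at most \<open>B \<delta>\<theta> / 2\<close>.

  \<^item> Change of likelihood.  For one prior and one observation, the posteriors under \<open>w\<close> and
    \<open>w*\<close> differ by an exponential tilt whose exponent, the log-likelihood ratio, is at most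
    \<open>2 B \<delta>w\<close> in absolute value.  A tilt with exponent in \<open>[-M, M]\<close> moves a probability
    vector by at most \<open>tanh (M/2) \<le> M/2\<close> (\<open>tv_dist_exponential_tilt\<close>), so this costs
    \<open>B \<delta>w\<close> for every observation.  The same lemma bounds the change of the transition model.

  \<^item> Change of prior.  A single observation may drive two posteriors far apart, but not on
    average under the predictive law \<open>q*\<close> of the true filter: the weight \<open>q*(y)\<close> cancels
    the normalizer of the true posterior, which leaves \<open>TV(p, p*) + TV(q, q*)\<close>, and
    \<open>q = L* p\<close> contracts again.  The factor is \<open>2 - \<kappa>Phi\<close>
    (\<open>expected_tv_dist_bayes_prior\<close>).

  Since the filter is exact for the true parameter, \<open>q*\<close> is the conditional law of the next
  observation given the past (\<open>pmf_obs_law_Suc\<close>).  Averaging over the past shows that the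
  expected error \<open>e\<close> obeys
  \<open>e (k+1) \<le> (2 - \<kappa>Phi) ((1 - \<kappa>P) e k + B \<delta>\<theta> / 2) + B \<delta>w\<close>, and
  \<open>2 - \<kappa>Phi \<le> 3 - 2 \<kappa>Phi \<le> 4 - 3 \<kappa>Phi\<close> as \<open>\<kappa>Phi \<le> 1\<close>.  Hence
  \<open>e (k+1) \<le> \<alpha> e k + c_b\<close>, and the geometric sum is the bound.
\<close>

section \<open>Total variation and finite kernels\<close>

definition prob_vec :: "('x::finite \<Rightarrow> real) \<Rightarrow> bool" where
  "prob_vec \<mu> \<longleftrightarrow> (\<forall>x. 0 \<le> \<mu> x) \<and> sum \<mu> UNIV = 1"

text \<open>
  The law after one step of the kernel \<open>K\<close>; with an observation kernel it is the predictive law of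
  the observation.
\<close>

definition push :: "('x::finite \<Rightarrow> 'z \<Rightarrow> real) \<Rightarrow> ('x \<Rightarrow> real) \<Rightarrow> 'z \<Rightarrow> real" where
  "push K \<mu> z = (\<Sum>x\<in>UNIV. K x z * \<mu> x)"

definition bayes :: "('x::finite \<Rightarrow> real) \<Rightarrow> ('x \<Rightarrow> real) \<Rightarrow> 'x \<Rightarrow> real" where
  "bayes L p x = L x * p x / (\<Sum>z\<in>UNIV. L z * p z)"

lemma prob_vec_nonneg: "prob_vec \<mu> \<Longrightarrow> 0 \<le> \<mu> x"
  and prob_vec_sum: "prob_vec \<mu> \<Longrightarrow> sum \<mu> UNIV = 1"
  by (auto simp: prob_vec_def)

lemma tv_dist_nonneg: "0 \<le> tv_dist \<mu> \<nu>"
  unfolding tv_dist_def by (simp add: sum_nonneg)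

lemma tv_dist_triangle: "tv_dist \<mu> \<rho> \<le> tv_dist \<mu> \<nu> + tv_dist \<nu> \<rho>"
  unfolding tv_dist_def
  by (simp add: field_simps flip: sum.distrib) (rule sum_mono, linarith)

lemma tv_dist_positive_part:
  assumes "sum \<mu> UNIV = sum \<nu> UNIV"
  shows "tv_dist \<mu> \<nu> = (\<Sum>s\<in>UNIV. max 0 (\<mu> s - \<nu> s))"
proof -
  have "(\<Sum>s\<in>UNIV. \<bar>\<mu> s - \<nu> s\<bar>) = (\<Sum>s\<in>UNIV. 2 * max 0 (\<mu> s - \<nu> s) - (\<mu> s - \<nu> s))"
    by (rule sum.cong) (auto simp: max_def)
  also have "\<dots> = 2 * (\<Sum>s\<in>UNIV. max 0 (\<mu> s - \<nu> s)) - (sum \<mu> UNIV - sum \<nu> UNIV)"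
    by (simp add: sum_subtractf sum_distrib_left)
  finally show ?thesis using assms by (simp add: tv_dist_def)
qed

lemma tv_dist_commute: "tv_dist \<mu> \<nu> = tv_dist \<nu> \<mu>"
  unfolding tv_dist_def by (simp add: abs_minus_commute)

lemma tv_dist_eq_overlap:
  assumes "prob_vec \<mu>" "prob_vec \<nu>"
  shows "tv_dist \<mu> \<nu> = 1 - (\<Sum>x\<in>UNIV. min (\<mu> x) (\<nu> x))"
proof -
  have "tv_dist \<mu> \<nu> = (\<Sum>s\<in>UNIV. \<mu> s - min (\<mu> s) (\<nu> s))"
    using assms by (subst tv_dist_positive_part)
      (auto simp: prob_vec_sum intro!: sum.cong)
  then show ?thesis using assms by (simp add: sum_subtractf prob_vec_sum)
qed

lemma prob_vec_push:
  assumes "\<And>x. prob_vec (K x)" "prob_vec \<mu>"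
  shows "prob_vec (push K \<mu>)"
proof -
  have "(\<Sum>z\<in>UNIV. push K \<mu> z) = (\<Sum>x\<in>UNIV. sum (K x) UNIV * \<mu> x)"
    unfolding push_def by (subst sum.swap) (simp add: sum_distrib_right)
  then have "(\<Sum>z\<in>UNIV. push K \<mu> z) = 1"
    using assms by (simp add: prob_vec_sum)
  then show ?thesis
    using assms by (auto simp: prob_vec_def push_def intro!: sum_nonneg)
qed

text \<open>
  Dobrushin's contraction.  The positive and the negative part of \<open>\<mu> - \<nu>\<close> have the same mass
  \<open>m = tv_dist \<mu> \<nu>\<close>, so the difference is transported by the product coupling of the two parts
  divided by \<open>m\<close>; each transported pair \<open>x, x'\<close> contributes
  \<open>tv_dist (K x) (K x') \<le> 1 - \<kappa>\<close>.  The proof multiplies by \<open>m\<close> to avoid the division.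
\<close>

lemma tv_dist_push_contraction:
  assumes K: "\<And>x. prob_vec (K x)"
    and \<kappa>: "\<And>x x'. \<kappa> \<le> (\<Sum>z\<in>UNIV. min (K x z) (K x' z))"
    and mass: "sum \<mu> UNIV = sum \<nu> UNIV"
  shows "tv_dist (push K \<mu>) (push K \<nu>) \<le> (1 - \<kappa>) * tv_dist \<mu> \<nu>"
proof -
  define m where "m = tv_dist \<mu> \<nu>"
  define p n where "p x = max 0 (\<mu> x - \<nu> x)" and "n x = max 0 (\<nu> x - \<mu> x)" for x
  have sp: "sum p UNIV = m" and sn: "sum n UNIV = m"
    using tv_dist_positive_part[OF mass] tv_dist_positive_part[OF mass[symmetric]]
    unfolding m_def p_def n_def by (simp_all add: tv_dist_commute)
  have pn: "\<mu> x - \<nu> x = p x - n x" for x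
    unfolding p_def n_def by auto
  have nn: "0 \<le> p x" "0 \<le> n x" for x
    unfolding p_def n_def by auto
  have diff: "push K \<mu> z - push K \<nu> z = (\<Sum>x\<in>UNIV. K x z * (p x - n x))" for z
    unfolding push_def pn[symmetric] by (simp add: sum_subtractf algebra_simps)
  have couple: "m * (push K \<mu> z - push K \<nu> z)
      = (\<Sum>x\<in>UNIV. \<Sum>x'\<in>UNIV. p x * n x' * (K x z - K x' z))" for z
  proof -
    have "(\<Sum>x\<in>UNIV. \<Sum>x'\<in>UNIV. p x * n x' * (K x z - K x' z))
        = (\<Sum>x\<in>UNIV. \<Sum>x'\<in>UNIV. (p x * K x z) * n x')
          - (\<Sum>x\<in>UNIV. \<Sum>x'\<in>UNIV. p x * (n x' * K x' z))"
      by (simp add: algebra_simps sum_subtractf)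
    also have "\<dots> = (\<Sum>x\<in>UNIV. p x * K x z) * sum n UNIV - sum p UNIV * (\<Sum>x\<in>UNIV. n x * K x z)"
      by (simp only: sum_product)
    also have "\<dots> = m * (\<Sum>x\<in>UNIV. K x z * (p x - n x))"
      by (simp add: sp sn algebra_simps sum_subtractf)
    finally show ?thesis by (simp add: diff)
  qed
  have "m * tv_dist (push K \<mu>) (push K \<nu>)
      = (1/2) * (\<Sum>z\<in>UNIV. \<bar>m * (push K \<mu> z - push K \<nu> z)\<bar>)"
    unfolding tv_dist_def[of "push K \<mu>"]
    using tv_dist_nonneg[of \<mu> \<nu>] by (simp add: m_def abs_mult sum_distrib_left)
  also have "\<dots> \<le> (1/2) * (\<Sum>z\<in>UNIV. \<Sum>x\<in>UNIV. \<Sum>x'\<in>UNIV. p x * n x' * \<bar>K x z - K x' z\<bar>)"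
    unfolding couple
    by (intro mult_left_mono sum_mono order.trans[OF sum_abs])
      (auto simp: abs_mult nn)
  also have "\<dots> = (1/2) * (\<Sum>x\<in>UNIV. \<Sum>z\<in>UNIV. \<Sum>x'\<in>UNIV. p x * n x' * \<bar>K x z - K x' z\<bar>)"
    by (subst sum.swap) (rule refl)
  also have "\<dots> = (1/2) * (\<Sum>x\<in>UNIV. \<Sum>x'\<in>UNIV. \<Sum>z\<in>UNIV. p x * n x' * \<bar>K x z - K x' z\<bar>)"
    by (intro arg_cong2[where f = times] sum.cong refl sum.swap)
  also have "\<dots> = (\<Sum>x\<in>UNIV. \<Sum>x'\<in>UNIV. p x * n x' * tv_dist (K x) (K x'))"
    unfolding tv_dist_def by (simp add: sum_distrib_left mult_ac)
  also have "\<dots> \<le> (\<Sum>x\<in>UNIV. \<Sum>x'\<in>UNIV. p x * n x' * (1 - \<kappa>))"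
    using \<kappa> by (intro sum_mono mult_left_mono)
      (auto simp: tv_dist_eq_overlap K nn)
  also have "\<dots> = m * ((1 - \<kappa>) * m)"
    by (simp add: sp sn mult_ac flip: sum_distrib_left sum_distrib_right)
  finally have *: "m * tv_dist (push K \<mu>) (push K \<nu>) \<le> m * ((1 - \<kappa>) * m)" .
  show ?thesis
  proof (cases "m = 0")
    case True
    then have "sum p UNIV = 0" "sum n UNIV = 0" using sp sn by auto
    then have "p x = 0" "n x = 0" for x
      using nn by (simp_all add: sum_nonneg_eq_0_iff)
    then have "tv_dist (push K \<mu>) (push K \<nu>) = 0"
      unfolding tv_dist_def diff by simp
    with True show ?thesis by (simp add: m_def)
  next
    case False
    then have "0 < m" using tv_dist_nonneg[of \<mu> \<nu>] by (simp add: m_def)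
    with * show ?thesis by (simp add: m_def)
  qed
qed

lemma tv_dist_push_kernel:
  assumes "prob_vec \<mu>" and C: "\<And>x. tv_dist (K x) (L x) \<le> C"
  shows "tv_dist (push K \<mu>) (push L \<mu>) \<le> C"
proof -
  have "tv_dist (push K \<mu>) (push L \<mu>)
      \<le> (1/2) * (\<Sum>z\<in>UNIV. \<Sum>x\<in>UNIV. \<bar>K x z - L x z\<bar> * \<mu> x)"
    unfolding tv_dist_def push_def sum_subtractf[symmetric] left_diff_distrib[symmetric]
    using assms(1)
    by (intro mult_left_mono sum_mono order.trans[OF sum_abs])
      (auto simp: abs_mult prob_vec_nonneg)
  also have "\<dots> = (\<Sum>x\<in>UNIV. tv_dist (K x) (L x) * \<mu> x)"
    unfolding tv_dist_def
    by (subst sum.swap) (simp add: sum_distrib_left sum_distrib_right mult_ac)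
  also have "\<dots> \<le> (\<Sum>x\<in>UNIV. C * \<mu> x)"
    using assms by (intro sum_mono mult_right_mono) (auto simp: prob_vec_nonneg)
  also have "\<dots> = C"
    using assms by (simp add: prob_vec_sum flip: sum_distrib_left)
  finally show ?thesis .
qed

section \<open>Stability of Bayes' rule\<close>

lemma normalizer_pos:
  assumes L: "\<And>x. 0 < L x" and p: "prob_vec p"
  shows "0 < (\<Sum>x\<in>UNIV. L x * p x)"
proof -
  have nonneg: "0 \<le> L x * p x" for x
    using L[of x] prob_vec_nonneg[OF p, of x] by simp
  obtain x where "p x \<noteq> 0"
    using prob_vec_sum[OF p] by (metis sum.neutral zero_neq_one)
  then have "0 < L x * p x"
    using L[of x] prob_vec_nonneg[OF p, of x] by simp
  then show ?thesis
    using nonneg by (intro sum_pos2[of UNIV x]) auto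
qed

lemma prob_vec_bayes:
  assumes L: "\<And>x. 0 < L x" and p: "prob_vec p"
  shows "prob_vec (bayes L p)"
proof -
  define Z where "Z = (\<Sum>x\<in>UNIV. L x * p x)"
  have Z: "0 < Z" unfolding Z_def using L p by (rule normalizer_pos)
  have "0 \<le> L x * p x / Z" for x
    using Z L[of x] prob_vec_nonneg[OF p, of x] by simp
  moreover have "(\<Sum>x\<in>UNIV. L x * p x / Z) = 1"
    using Z by (simp add: Z_def flip: sum_divide_distrib)
  ultimately show ?thesis by (simp add: prob_vec_def bayes_def Z_def)
qed

text \<open>
  Replacing a likelihood acts on the posterior, whatever the prior is; this turns a change of the
  observation model into a tilt of a single probability vector.
\<close>

lemma bayes_reweight:
  assumes L: "\<And>x. 0 < L x" "\<And>x. 0 < L' x" and "prob_vec p"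
  shows "bayes L p = bayes (\<lambda>x. L x / L' x) (bayes L' p)"
proof
  fix x
  define Z where "Z = (\<Sum>z\<in>UNIV. L' z * p z)"
  have Z: "Z \<noteq> 0" using normalizer_pos[of L' p] assms by (auto simp: Z_def)
  have "L z / L' z * (L' z * p z / Z) = L z * p z / Z" for z
    using L(2)[of z] by simp
  then show "bayes L p x = bayes (\<lambda>x. L x / L' x) (bayes L' p) x"
    using Z unfolding bayes_def Z_def[symmetric]
    by (simp flip: sum_divide_distrib)
qed

text \<open>
  This is \<open>tanh (M/2) \<le> M/2\<close>, in the form in which the tilt bound produces the left-hand side.
\<close>

lemma exp_ratio_le_half:
  fixes M :: real
  assumes "0 \<le> M"
  shows "(exp M - 1) / (exp M + 1) \<le> M / 2"
proof -
  define f where "f x = (x - 2) * exp x + x + 2" for x :: real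
  have "f 0 \<le> f M"
  proof (rule DERIV_nonneg_imp_nondecreasing[OF assms])
    fix x :: real assume "0 \<le> x" "x \<le> M"
    have "(f has_real_derivative (x - 1) * exp x + 1) (at x)"
      unfolding f_def by (auto intro!: derivative_eq_intros simp: algebra_simps)
    moreover have "(1 - x) * exp x \<le> exp (- x) * exp x"
      using exp_ge_add_one_self[of "- x"] by (intro mult_right_mono) auto
    then have "0 \<le> (x - 1) * exp x + 1"
      by (simp add: algebra_simps flip: exp_add)
    ultimately show "\<exists>y. (f has_real_derivative y) (at x) \<and> 0 \<le> y" by blast
  qed
  then have "2 * (exp M - 1) \<le> M * (exp M + 1)"
    by (simp add: f_def algebra_simps)
  then show ?thesis
    by (simp add: field_simps add_pos_pos)
qed

text \<open>
  Let \<open>A\<close> be the event on which the tilted vector exceeds \<open>\<mu>\<close>, and \<open>a = \<mu>(A)\<close>.  The tilted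
  mass of \<open>A\<close> is largest when the exponent is \<open>M\<close> on \<open>A\<close> and \<open>-M\<close> off \<open>A\<close>, so with
  \<open>E = exp M\<close> the distance is at most \<open>E\<^sup>2 a / (E\<^sup>2 a + 1 - a) - a\<close>.  Maximized over \<open>a\<close>, at
  \<open>a = 1 / (E + 1)\<close>, this is \<open>(E - 1) / (E + 1) = tanh (M/2)\<close>.
\<close>

lemma tv_dist_exponential_tilt:
  assumes \<mu>: "prob_vec \<mu>" and h: "\<And>x. \<bar>h x\<bar> \<le> M"
  shows "tv_dist (bayes (\<lambda>x. exp (h x)) \<mu>) \<mu> \<le> M / 2"
proof -
  define \<nu> where "\<nu> = bayes (\<lambda>x. exp (h x)) \<mu>"
  define A where "A = {x. \<mu> x < \<nu> x}"
  define E a S T where "E = exp M" and "a = sum \<mu> A"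
    and "S = (\<Sum>x\<in>A. exp (h x) * \<mu> x)" and "T = (\<Sum>x\<in>-A. exp (h x) * \<mu> x)"
  have M: "0 \<le> M" using h by (meson abs_ge_zero order.trans)
  then have E: "1 \<le> E" by (simp add: E_def)
  have split: "sum g UNIV = sum g A + sum g (-A)" for g :: "'a \<Rightarrow> real"
    using sum.union_disjoint[of A "-A" g] by (simp add: Compl_partition)
  have aC: "sum \<mu> (-A) = 1 - a"
    using split[of \<mu>] prob_vec_sum[OF \<mu>] by (simp add: a_def)
  have a: "0 \<le> a" and a1: "a \<le> 1"
    using aC sum_nonneg[of "-A" \<mu>] by (auto simp: a_def prob_vec_nonneg[OF \<mu>] intro!: sum_nonneg)
  have ST: "0 < S + T"
    using normalizer_pos[of "\<lambda>x. exp (h x)", OF _ \<mu>] split[of "\<lambda>x. exp (h x) * \<mu> x"]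
    by (simp add: S_def T_def)
  have S0: "0 \<le> S" and T0: "0 \<le> T"
    unfolding S_def T_def using prob_vec_nonneg[OF \<mu>] by (auto intro!: sum_nonneg)
  have hu: "exp (h x) \<le> E" for x
    using h[of x] by (simp add: E_def abs_le_iff)
  have hl: "1 / E \<le> exp (h x)" for x
    using h[of x] by (simp add: E_def abs_le_iff flip: exp_minus inverse_eq_divide)
  have SE: "S \<le> E * a"
    unfolding S_def a_def sum_distrib_left
    using hu prob_vec_nonneg[OF \<mu>] by (intro sum_mono mult_right_mono) auto
  have "1 / E * (1 - a) \<le> T"
    unfolding T_def aC[symmetric] sum_distrib_left
    using hl prob_vec_nonneg[OF \<mu>] by (intro sum_mono mult_right_mono) auto
  then have TE: "1 - a \<le> E * T"
    using E by (simp add: field_simps)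
  have "tv_dist \<nu> \<mu> = (\<Sum>x\<in>UNIV. max 0 (\<nu> x - \<mu> x))"
    using \<mu> prob_vec_bayes[of "\<lambda>x. exp (h x)", OF _ \<mu>]
    by (intro tv_dist_positive_part) (simp add: \<nu>_def prob_vec_sum)
  also have "\<dots> = (\<Sum>x\<in>A. \<nu> x - \<mu> x)"
    unfolding split by (auto simp: A_def intro!: sum.cong sum.neutral)
  also have "\<dots> = S / (S + T) - a"
    unfolding sum_subtractf a_def
    by (simp add: \<nu>_def bayes_def S_def T_def split[of "\<lambda>x. exp (h x) * \<mu> x"] flip: sum_divide_distrib)
  also have "\<dots> \<le> (E - 1) / (E + 1)"
  proof -
    define D where "D = E\<^sup>2 * a + (1 - a)"
    have "1 * a \<le> E\<^sup>2 * a"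
      using E a by (intro mult_right_mono) (auto simp: one_le_power)
    then have D: "0 < D"
      unfolding D_def using a a1 E by linarith
    have "S * (1 - a) \<le> (E * a) * (E * T)"
      using SE TE S0 a a1 E by (intro mult_mono) auto
    then have "S * D \<le> E\<^sup>2 * a * (S + T)"
      by (simp add: D_def algebra_simps power2_eq_square)
    then have "S / (S + T) \<le> E\<^sup>2 * a / D"
      using ST D by (simp add: divide_le_eq le_divide_eq mult_ac)
    moreover have "E\<^sup>2 * a / D - a \<le> (E - 1) / (E + 1)"
    proof -
      \<comment> \<open>The square vanishes at the maximizer \<open>a = 1 / (E + 1)\<close>.\<close>
      have "0 \<le> (E - 1) * (a * (E + 1) - 1)\<^sup>2"
        using E by simp
      also have "\<dots> = (E - 1) * D - (E\<^sup>2 * a - a * D) * (E + 1)"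
        by (simp add: D_def algebra_simps power2_eq_square)
      finally have "(E\<^sup>2 * a - a * D) * (E + 1) \<le> (E - 1) * D" by simp
      then have "(E\<^sup>2 * a - a * D) / D \<le> (E - 1) / (E + 1)"
        using D E by (simp add: divide_le_eq le_divide_eq mult_ac)
      then show ?thesis using D by (simp add: diff_divide_distrib)
    qed
    ultimately show ?thesis by linarith
  qed
  also have "\<dots> \<le> M / 2"
    unfolding E_def by (rule exp_ratio_le_half[OF M])
  finally show ?thesis by (simp add: \<nu>_def)
qed

lemma tv_dist_bayes_likelihood:
  assumes L: "\<And>x. 0 < L x" "\<And>x. 0 < L' x" and p: "prob_vec p"
    and h: "\<And>x. \<bar>ln (L x / L' x)\<bar> \<le> M"
  shows "tv_dist (bayes L p) (bayes L' p) \<le> M / 2"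
proof -
  have "bayes L p = bayes (\<lambda>x. exp (ln (L x / L' x))) (bayes L' p)"
    using bayes_reweight[OF L p] L by simp
  then show ?thesis
    using tv_dist_exponential_tilt[OF prob_vec_bayes[OF L(2) p] h] by simp
qed

text \<open>
  The observation is drawn from the predictive law \<open>q'\<close> of the second prior.  Weighted by \<open>q' y\<close>,
  the second posterior becomes the joint weight \<open>L x y * p' x\<close>, while the first becomes
  \<open>L x y * p x\<close> times the mismatch \<open>q' y / q y\<close> of the two normalizers.  The joint weights differ by
  \<open>tv_dist p p'\<close> in total and the mismatch costs \<open>tv_dist q q'\<close>, which is at most
  \<open>(1 - \<kappa>) * tv_dist p p'\<close>.
\<close>

lemma expected_tv_dist_bayes_prior:
  assumes L: "\<And>x. prob_vec (L x)" "\<And>x y. 0 < L x y"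
    and \<kappa>: "\<And>x x'. \<kappa> \<le> (\<Sum>y\<in>UNIV. min (L x y) (L x' y))"
    and p: "prob_vec p" and p': "prob_vec p'"
  shows "(\<Sum>y\<in>UNIV. push L p' y * tv_dist (bayes (\<lambda>x. L x y) p) (bayes (\<lambda>x. L x y) p'))
      \<le> (2 - \<kappa>) * tv_dist p p'"
proof -
  define q q' where "q = push L p" and "q' = push L p'"
  have q: "0 < q y" and q': "0 < q' y" for y
    using normalizer_pos[of "\<lambda>x. L x y"] L p p' by (auto simp: q_def q'_def push_def)
  have pt: "q' y * tv_dist (bayes (\<lambda>x. L x y) p) (bayes (\<lambda>x. L x y) p')
      \<le> (1/2) * (\<Sum>x\<in>UNIV. L x y * \<bar>p x - p' x\<bar>) + (1/2) * \<bar>q y - q' y\<bar>" for y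
  proof -
    have 1: "q' y * \<bar>bayes (\<lambda>x. L x y) p x - bayes (\<lambda>x. L x y) p' x\<bar>
        \<le> L x y * \<bar>p x - p' x\<bar> + L x y * p x * (\<bar>q y - q' y\<bar> / q y)" for x
    proof -
      have "q' y * \<bar>bayes (\<lambda>x. L x y) p x - bayes (\<lambda>x. L x y) p' x\<bar>
          = \<bar>q' y * (L x y * p x / q y - L x y * p' x / q' y)\<bar>"
        using q'[of y] by (simp add: abs_mult bayes_def q_def q'_def push_def)
      also have "q' y * (L x y * p x / q y - L x y * p' x / q' y)
          = L x y * (p x - p' x) - L x y * p x * ((q y - q' y) / q y)"
        using q[of y] q'[of y] by (simp add: field_simps)
      also have "\<bar>\<dots>\<bar> \<le> \<bar>L x y * (p x - p' x)\<bar> + \<bar>L x y * p x * ((q y - q' y) / q y)\<bar>"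
        by (rule abs_triangle_ineq4)
      also have "\<dots> = L x y * \<bar>p x - p' x\<bar> + L x y * p x * (\<bar>q y - q' y\<bar> / q y)"
        using q[of y] L(2)[of x y] prob_vec_nonneg[OF p, of x] by (simp add: abs_mult)
      finally show ?thesis .
    qed
    have "q' y * tv_dist (bayes (\<lambda>x. L x y) p) (bayes (\<lambda>x. L x y) p')
        = (1/2) * (\<Sum>x\<in>UNIV. q' y * \<bar>bayes (\<lambda>x. L x y) p x - bayes (\<lambda>x. L x y) p' x\<bar>)"
      by (simp add: tv_dist_def sum_distrib_left)
    also have "\<dots> \<le> (1/2) * (\<Sum>x\<in>UNIV. L x y * \<bar>p x - p' x\<bar> + L x y * p x * (\<bar>q y - q' y\<bar> / q y))"
      by (intro mult_left_mono sum_mono 1) auto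
    also have "\<dots> = (1/2) * (\<Sum>x\<in>UNIV. L x y * \<bar>p x - p' x\<bar>) + (1/2) * (q y * (\<bar>q y - q' y\<bar> / q y))"
      unfolding sum.distrib sum_distrib_right[symmetric]
      by (simp add: q_def push_def distrib_left)
    finally show ?thesis using q[of y] by simp
  qed
  have "(\<Sum>y\<in>UNIV. q' y * tv_dist (bayes (\<lambda>x. L x y) p) (bayes (\<lambda>x. L x y) p'))
      \<le> (\<Sum>y\<in>UNIV. (1/2) * (\<Sum>x\<in>UNIV. L x y * \<bar>p x - p' x\<bar>) + (1/2) * \<bar>q y - q' y\<bar>)"
    by (intro sum_mono pt)
  also have "\<dots> = (1/2) * (\<Sum>x\<in>UNIV. sum (L x) UNIV * \<bar>p x - p' x\<bar>) + tv_dist q q'"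
    unfolding sum.distrib sum_distrib_left[symmetric] sum_distrib_right tv_dist_def
    by (subst sum.swap) simp
  also have "\<dots> = tv_dist p p' + tv_dist q q'"
    using L(1) by (simp add: prob_vec_sum tv_dist_def)
  also have "tv_dist q q' \<le> (1 - \<kappa>) * tv_dist p p'"
    unfolding q_def q'_def
    using p p' by (intro tv_dist_push_contraction L \<kappa>) (simp add: prob_vec_sum)
  finally show ?thesis by (simp add: q'_def algebra_simps)
qed

text \<open>
  The likelihood is changed first, at the common prior \<open>p\<close>, where the bound holds for every
  observation.  The prior is changed second, under the likelihood \<open>L'\<close>, because the averaging
  argument needs the law of the observation and the likelihood to come from the same kernel.
  Hence the overlap of observation laws is that of \<open>L'\<close>.
\<close>

lemma expected_tv_dist_filter_step:
  assumes K: "\<And>x. prob_vec (K x)" "\<And>x. prob_vec (K' x)"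
    and L: "\<And>x y. 0 < L x y" and L': "\<And>x. prob_vec (L' x)" "\<And>x y. 0 < L' x y"
    and \<kappa>K: "\<And>x x'. \<kappa>K \<le> (\<Sum>z\<in>UNIV. min (K x z) (K x' z))"
    and \<kappa>L: "\<And>x x'. \<kappa>L \<le> (\<Sum>y\<in>UNIV. min (L' x y) (L' x' y))" and "\<kappa>L \<le> 1"
    and e: "\<And>x. tv_dist (K x) (K' x) \<le> e"
    and M: "\<And>x y. \<bar>ln (L x y / L' x y)\<bar> \<le> M"
    and b: "prob_vec b" and b': "prob_vec b'"
  shows "(\<Sum>y\<in>UNIV. push L' (push K' b') y *
        tv_dist (bayes (\<lambda>x. L x y) (push K b)) (bayes (\<lambda>x. L' x y) (push K' b')))
      \<le> (2 - \<kappa>L) * ((1 - \<kappa>K) * tv_dist b b' + e) + M / 2"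
proof -
  define p p' q where "p = push K b" and "p' = push K' b'" and "q = push L' p'"
  have p: "prob_vec p" and p': "prob_vec p'"
    unfolding p_def p'_def by (intro prob_vec_push K b b')+
  have q: "prob_vec q"
    unfolding q_def by (intro prob_vec_push L' p')
  have predict: "tv_dist p p' \<le> (1 - \<kappa>K) * tv_dist b b' + e"
  proof -
    have "tv_dist p p' \<le> tv_dist (push K b) (push K b') + tv_dist (push K b') (push K' b')"
      unfolding p_def p'_def by (rule tv_dist_triangle)
    also have "tv_dist (push K b) (push K b') \<le> (1 - \<kappa>K) * tv_dist b b'"
      using b b' by (intro tv_dist_push_contraction K \<kappa>K) (simp add: prob_vec_sum)
    also have "tv_dist (push K b') (push K' b') \<le> e"
      by (intro tv_dist_push_kernel b' e)
    finally show ?thesis by simp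
  qed
  have "(\<Sum>y\<in>UNIV. q y * tv_dist (bayes (\<lambda>x. L x y) p) (bayes (\<lambda>x. L' x y) p'))
      \<le> (\<Sum>y\<in>UNIV. q y * (M / 2 + tv_dist (bayes (\<lambda>x. L' x y) p) (bayes (\<lambda>x. L' x y) p')))"
  proof (intro sum_mono mult_left_mono)
    fix y
    show "tv_dist (bayes (\<lambda>x. L x y) p) (bayes (\<lambda>x. L' x y) p')
        \<le> M / 2 + tv_dist (bayes (\<lambda>x. L' x y) p) (bayes (\<lambda>x. L' x y) p')"
      using tv_dist_bayes_likelihood[of "\<lambda>x. L x y" "\<lambda>x. L' x y", OF L L'(2) p M]
      by (intro order.trans[OF tv_dist_triangle add_right_mono])
    show "0 \<le> q y" by (rule prob_vec_nonneg[OF q])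
  qed
  also have "\<dots> = M / 2 + (\<Sum>y\<in>UNIV. q y * tv_dist (bayes (\<lambda>x. L' x y) p) (bayes (\<lambda>x. L' x y) p'))"
    using prob_vec_sum[OF q]
    by (simp add: distrib_left sum.distrib flip: sum_distrib_right sum_divide_distrib)
  also have "\<dots> \<le> M / 2 + (2 - \<kappa>L) * tv_dist p p'"
    unfolding q_def by (intro add_left_mono expected_tv_dist_bayes_prior L' \<kappa>L p p')
  also have "\<dots> \<le> M / 2 + (2 - \<kappa>L) * ((1 - \<kappa>K) * tv_dist b b' + e)"
    using predict \<open>\<kappa>L \<le> 1\<close> by (intro add_left_mono mult_left_mono) auto
  finally show ?thesis by (simp add: p_def p'_def q_def)
qed

section \<open>Log-linear models\<close>

definition softmax :: "('x::finite \<Rightarrow> real) \<Rightarrow> 'x \<Rightarrow> real" where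
  "softmax f x = exp (f x) / (\<Sum>z\<in>UNIV. exp (f z))"

lemma partition_pos: "0 < (\<Sum>z\<in>UNIV. exp (f z :: real))" for f :: "'x::finite \<Rightarrow> real"
  by (rule sum_pos) auto

lemma softmax_pos: "0 < softmax f x"
  unfolding softmax_def using partition_pos[of f] by simp

lemma prob_vec_softmax: "prob_vec (softmax f)"
  unfolding prob_vec_def
proof
  show "\<forall>x. 0 \<le> softmax f x" by (simp add: softmax_pos less_imp_le)
  show "sum (softmax f) UNIV = 1"
    using partition_pos[of f] by (simp add: softmax_def flip: sum_divide_distrib)
qed

lemma trans_prob_softmax: "trans_prob \<phi>p \<theta> s a = softmax (\<lambda>x. \<theta> \<bullet> \<phi>p s a x)"
  by (rule ext) (simp add: trans_prob_def softmax_def)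

lemma obs_prob_softmax: "obs_prob \<phi>o w s = softmax (\<lambda>y. w \<bullet> \<phi>o s y)"
  by (rule ext) (simp add: obs_prob_def softmax_def)

lemma prob_vec_trans_prob: "prob_vec (trans_prob \<phi>p \<theta> s a)"
  by (simp add: trans_prob_softmax prob_vec_softmax)

lemma prob_vec_obs_prob: "prob_vec (obs_prob \<phi>o w s)"
  by (simp add: obs_prob_softmax prob_vec_softmax)

lemma obs_prob_pos: "0 < obs_prob \<phi>o w s y"
  by (simp add: obs_prob_softmax softmax_pos)

lemma softmax_eq_tilt: "softmax f = bayes (\<lambda>x. exp (f x - g x)) (softmax g)"
proof
  fix x
  define Z where "Z = (\<Sum>z\<in>UNIV. exp (g z))"
  have Z: "0 < Z" unfolding Z_def by (rule partition_pos)
  have "exp (f z - g z) * (exp (g z) / Z) = exp (f z) / Z" for z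
    by (simp add: exp_diff)
  then show "softmax f x = bayes (\<lambda>x. exp (f x - g x)) (softmax g) x"
    using Z by (simp add: bayes_def softmax_def Z_def[symmetric] flip: sum_divide_distrib)
qed

lemma tv_dist_softmax:
  assumes "\<And>x. \<bar>f x - g x\<bar> \<le> M"
  shows "tv_dist (softmax f) (softmax g) \<le> M / 2"
  unfolding softmax_eq_tilt[of f g]
  by (rule tv_dist_exponential_tilt[OF prob_vec_softmax assms])

lemma ln_partition_diff:
  fixes f g :: "'x::finite \<Rightarrow> real"
  assumes "\<And>x. \<bar>f x - g x\<bar> \<le> M"
  shows "ln (\<Sum>z\<in>UNIV. exp (f z)) \<le> M + ln (\<Sum>z\<in>UNIV. exp (g z))"
proof -
  have "(\<Sum>z\<in>UNIV. exp (f z)) \<le> (\<Sum>z\<in>UNIV. exp M * exp (g z))"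
  proof (rule sum_mono)
    fix z
    show "exp (f z) \<le> exp M * exp (g z)"
      using assms[of z] by (simp add: abs_le_iff flip: exp_add)
  qed
  then have "ln (\<Sum>z\<in>UNIV. exp (f z)) \<le> ln (exp M * (\<Sum>z\<in>UNIV. exp (g z)))"
    using partition_pos[of f] by (simp add: sum_distrib_left)
  also have "\<dots> = M + ln (\<Sum>z\<in>UNIV. exp (g z))"
    using partition_pos[of g] by (simp add: ln_mult)
  finally show ?thesis .
qed

text \<open>
  The exponents contribute \<open>M\<close> and the log-partition functions another \<open>M\<close>.  The partition
  functions cannot be ignored here: as likelihoods, the values are compared across states, and
  each state has its own normalizer.
\<close>

lemma abs_ln_softmax_ratio:
  assumes M: "\<And>x. \<bar>f x - g x\<bar> \<le> M"
  shows "\<bar>ln (softmax f x / softmax g x)\<bar> \<le> 2 * M"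
proof -
  have "ln (softmax f x / softmax g x) = (f x - g x)
      - (ln (\<Sum>z\<in>UNIV. exp (f z)) - ln (\<Sum>z\<in>UNIV. exp (g z)))"
    using partition_pos[of f] partition_pos[of g]
    by (simp add: ln_div softmax_pos) (simp add: softmax_def ln_div)
  moreover have "ln (\<Sum>z\<in>UNIV. exp (f z)) \<le> M + ln (\<Sum>z\<in>UNIV. exp (g z))"
    by (rule ln_partition_diff) (rule M)
  moreover have "ln (\<Sum>z\<in>UNIV. exp (g z)) \<le> M + ln (\<Sum>z\<in>UNIV. exp (f z))"
    by (rule ln_partition_diff) (subst abs_minus_commute, rule M)
  ultimately show ?thesis using M[of x] by linarith
qed

lemma abs_inner_diff_le:
  fixes u v x :: "'v::real_inner"
  assumes "norm x \<le> B"
  shows "\<bar>u \<bullet> x - v \<bullet> x\<bar> \<le> B * norm (u - v)"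
proof -
  have "\<bar>u \<bullet> x - v \<bullet> x\<bar> \<le> norm (u - v) * norm x"
    by (simp add: Cauchy_Schwarz_ineq2 flip: inner_diff_left)
  also have "\<dots> \<le> norm (u - v) * B"
    using assms by (rule mult_left_mono) simp
  finally show ?thesis by (simp add: mult.commute)
qed

lemma tv_dist_trans_prob:
  assumes "\<And>s a s'. norm (\<phi>p s a s') \<le> B"
  shows "tv_dist (trans_prob \<phi>p \<theta> s a) (trans_prob \<phi>p \<theta>' s a) \<le> B * norm (\<theta> - \<theta>') / 2"
  unfolding trans_prob_softmax by (intro tv_dist_softmax abs_inner_diff_le assms)

lemma abs_ln_obs_prob_ratio:
  assumes "\<And>s y. norm (\<phi>o s y) \<le> B"
  shows "\<bar>ln (obs_prob \<phi>o w s y / obs_prob \<phi>o w' s y)\<bar> \<le> 2 * (B * norm (w - w'))"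
  unfolding obs_prob_softmax by (intro abs_ln_softmax_ratio abs_inner_diff_le assms)

lemma kappa_P_le:
  assumes "(\<theta>, w) \<in> F"
  shows "kappa_P \<phi>p F \<le> (\<Sum>x\<in>UNIV. min (trans_prob \<phi>p \<theta> s a x) (trans_prob \<phi>p \<theta> s' a x))"
proof -
  let ?g = "\<lambda>\<theta> (s, s', a). \<Sum>x\<in>UNIV. min (trans_prob \<phi>p \<theta> s a x) (trans_prob \<phi>p \<theta> s' a x)"
  have overlap: "0 \<le> (\<Sum>x\<in>UNIV. min (trans_prob \<phi>p \<theta> s a x) (trans_prob \<phi>p \<theta> s' a x))" for \<theta> s s' a
    by (simp add: prob_vec_nonneg[OF prob_vec_trans_prob] sum_nonneg)
  then have nn: "0 \<le> ?g \<theta> z" for \<theta> z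
    by (auto split: prod.split)
  have "kappa_P \<phi>p F \<le> (case (\<theta>, w) of (\<theta>, w) \<Rightarrow> INF z. ?g \<theta> z)"
    unfolding kappa_P_def using assms
    by (intro cINF_lower) (auto intro!: bdd_belowI2[of _ 0] cINF_greatest overlap)
  also have "\<dots> \<le> ?g \<theta> (s, s', a)"
    using cINF_lower[of "?g \<theta>" UNIV "(s, s', a)"] bdd_belowI2[of UNIV 0 "?g \<theta>"] nn by auto
  finally show ?thesis by simp
qed

lemma kappa_Phi_le:
  assumes "(\<theta>, w) \<in> F"
  shows "kappa_Phi \<phi>o F \<le> (\<Sum>y\<in>UNIV. min (obs_prob \<phi>o w s y) (obs_prob \<phi>o w s' y))"
proof -
  let ?g = "\<lambda>w (s, s'). \<Sum>y\<in>UNIV. min (obs_prob \<phi>o w s y) (obs_prob \<phi>o w s' y)"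
  have overlap: "0 \<le> (\<Sum>y\<in>UNIV. min (obs_prob \<phi>o w s y) (obs_prob \<phi>o w s' y))" for w s s'
    by (simp add: prob_vec_nonneg[OF prob_vec_obs_prob] sum_nonneg)
  then have nn: "0 \<le> ?g w z" for w z
    by (auto split: prod.split)
  have "kappa_Phi \<phi>o F \<le> (case (\<theta>, w) of (\<theta>, w) \<Rightarrow> INF z. ?g w z)"
    unfolding kappa_Phi_def using assms
    by (intro cINF_lower) (auto intro!: bdd_belowI2[of _ 0] cINF_greatest overlap)
  also have "\<dots> \<le> ?g w (s, s')"
    using cINF_lower[of "?g w" UNIV "(s, s')"] bdd_belowI2[of UNIV 0 "?g w"] nn by auto
  finally show ?thesis by simp
qed

section \<open>The observation law and the exactness of the filter\<close>

lemma belief_Suc_eq_bayes_push: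
  "belief \<phi>p \<phi>o \<nu>0 \<theta> w a ys (Suc k) =
     bayes (\<lambda>s. obs_prob \<phi>o w s (ys ! k))
       (push (\<lambda>s. trans_prob \<phi>p \<theta> s (a k)) (belief \<phi>p \<phi>o \<nu>0 \<theta> w a ys k))"
  by (rule ext) (simp add: bayes_def push_def)

lemma belief_append:
  "k \<le> length ys \<Longrightarrow> belief \<phi>p \<phi>o \<nu>0 \<theta> w a (ys @ zs) k = belief \<phi>p \<phi>o \<nu>0 \<theta> w a ys k"
  by (induction k) (simp_all add: belief_Suc_eq_bayes_push nth_append del: belief.simps(2))

lemma prob_vec_belief: "prob_vec (belief \<phi>p \<phi>o \<nu>0 \<theta> w a ys k)"
proof (induction k)
  case 0
  then show ?case by (simp add: prob_vec_def sum_pmf_eq_1)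
next
  case (Suc k)
  then show ?case
    unfolding belief_Suc_eq_bayes_push
    by (intro prob_vec_bayes prob_vec_push obs_prob_pos prob_vec_trans_prob)
qed

lemma length_state_obs_law:
  "(s, ys) \<in> set_pmf (state_obs_law \<phi>p \<phi>o \<nu>0 \<theta> w a k) \<Longrightarrow> length ys = k"
  by (induction k arbitrary: s ys) auto

lemma finite_lists_length: "finite {ys :: 'o::finite list. length ys = k}"
  using finite_lists_length_eq[of "UNIV :: 'o set" k] by simp

lemma pmf_state_obs_law_Suc:
  assumes "length ys = k"
  shows "pmf (state_obs_law \<phi>p \<phi>o \<nu>0 \<theta> w a (Suc k)) (s', ys @ [y]) =
    obs_prob \<phi>o w s' y *
      (\<Sum>s\<in>UNIV. trans_prob \<phi>p \<theta> s (a k) s' * pmf (state_obs_law \<phi>p \<phi>o \<nu>0 \<theta> w a k) (s, ys))"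
proof -
  let ?J = "state_obs_law \<phi>p \<phi>o \<nu>0 \<theta> w a k"
  let ?T = "\<lambda>(s, zs). bind_pmf (trans_pmf \<phi>p \<theta> s (a k)) (\<lambda>s'.
         map_pmf (\<lambda>y. (s', zs @ [y])) (obs_pmf \<phi>o w s'))"
  have emit: "pmf (map_pmf (\<lambda>y. (s'', zs @ [y])) (obs_pmf \<phi>o w s'')) (s', ys @ [y])
      = (if s'' = s' \<and> zs = ys then obs_prob \<phi>o w s' y else 0)" for s'' zs
  proof (cases "s'' = s' \<and> zs = ys")
    case True
    then show ?thesis
      using pmf_map_inj'[of "\<lambda>y. (s', ys @ [y])" "obs_pmf \<phi>o w s'" y]
      by (auto simp: pmf_obs_pmf inj_on_def)
  next
    case False
    then show ?thesis by (auto simp: pmf_eq_0_set_pmf)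
  qed
  have step: "pmf (?T x) (s', ys @ [y])
      = (if snd x = ys then trans_prob \<phi>p \<theta> (fst x) (a k) s' * obs_prob \<phi>o w s' y else 0)" for x
    by (cases x) (auto simp: pmf_bind emit integral_measure_pmf[of UNIV] pmf_trans_pmf if_distrib
        cong: if_cong)
  have "pmf (state_obs_law \<phi>p \<phi>o \<nu>0 \<theta> w a (Suc k)) (s', ys @ [y])
      = (\<Sum>x\<in>UNIV \<times> {zs. length zs = k}. pmf ?J x * pmf (?T x) (s', ys @ [y]))"
    unfolding state_obs_law.simps pmf_bind
    by (subst integral_measure_pmf[of "UNIV \<times> {zs. length zs = k}"])
      (auto simp: finite_lists_length dest: length_state_obs_law)
  also have "\<dots> = (\<Sum>s\<in>UNIV. \<Sum>zs | length zs = k.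
      if zs = ys then pmf ?J (s, zs) * (trans_prob \<phi>p \<theta> s (a k) s' * obs_prob \<phi>o w s' y) else 0)"
    unfolding sum.cartesian_product step
    by (intro sum.cong refl) (auto simp: case_prod_unfold)
  also have "\<dots> = (\<Sum>s\<in>UNIV. pmf ?J (s, ys) * (trans_prob \<phi>p \<theta> s (a k) s' * obs_prob \<phi>o w s' y))"
    using assms by (simp add: finite_lists_length)
  finally show ?thesis by (simp add: sum_distrib_left mult_ac)
qed

lemma pmf_obs_law:
  fixes \<phi>p :: "('s::finite, 'a, 'p::finite) trans_feature"
  shows "pmf (obs_law \<phi>p \<phi>o \<nu>0 \<theta> w a k) ys = (\<Sum>s\<in>UNIV. pmf (state_obs_law \<phi>p \<phi>o \<nu>0 \<theta> w a k) (s, ys))"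
proof -
  have "snd -` {ys} = (\<lambda>s. (s, ys)) ` (UNIV :: 's set)" by auto
  then show ?thesis
    unfolding obs_law_def pmf_map
    by (simp add: measure_measure_pmf_finite sum.reindex inj_on_def)
qed

text \<open>
  Exactness of the filter: at the parameter that generates the data, the belief is the
  conditional law of the current state given the observations.  In product form this also holds
  for histories of probability zero, so no conditioning is needed.
\<close>

lemma pmf_state_obs_law_eq_belief:
  fixes \<phi>o :: "('s::finite, 'o::finite, 'q::finite) obs_feature"
  assumes "length ys = k"
  shows "pmf (state_obs_law \<phi>p \<phi>o \<nu>0 \<theta> w a k) (s, ys)
    = belief \<phi>p \<phi>o \<nu>0 \<theta> w a ys k s * pmf (obs_law \<phi>p \<phi>o \<nu>0 \<theta> w a k) ys"
  using assms
proof (induction k arbitrary: s ys)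
  case 0
  have "pmf (map_pmf (\<lambda>s. (s, [] :: 'o list)) \<nu>0) (s, []) = pmf \<nu>0 s" for s
    by (rule pmf_map_inj') (simp add: inj_on_def)
  with 0 show ?case
    by (simp add: pmf_obs_law sum_pmf_eq_1)
next
  case (Suc k)
  then obtain zs y where ys: "ys = zs @ [y]" and len: "length zs = k"
    by (metis length_Suc_conv_rev)
  define m where "m = pmf (obs_law \<phi>p \<phi>o \<nu>0 \<theta> w a k) zs"
  define p where "p = push (\<lambda>s. trans_prob \<phi>p \<theta> s (a k)) (belief \<phi>p \<phi>o \<nu>0 \<theta> w a zs k)"
  define Z where "Z = (\<Sum>s\<in>UNIV. obs_prob \<phi>o w s y * p s)"
  have J: "pmf (state_obs_law \<phi>p \<phi>o \<nu>0 \<theta> w a (Suc k)) (s, ys) = obs_prob \<phi>o w s y * p s * m" for s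
    unfolding ys pmf_state_obs_law_Suc[OF len] Suc.IH[OF len] p_def push_def m_def
    by (simp add: sum_distrib_left sum_distrib_right mult_ac)
  have "prob_vec p"
    unfolding p_def by (intro prob_vec_push prob_vec_trans_prob prob_vec_belief)
  then have "0 < Z"
    unfolding Z_def by (intro normalizer_pos obs_prob_pos)
  moreover have "pmf (obs_law \<phi>p \<phi>o \<nu>0 \<theta> w a (Suc k)) ys = Z * m"
    unfolding pmf_obs_law J Z_def by (simp add: sum_distrib_right)
  moreover have "belief \<phi>p \<phi>o \<nu>0 \<theta> w a ys (Suc k) s = obs_prob \<phi>o w s y * p s / Z"
    unfolding belief_Suc_eq_bayes_push
    by (simp add: ys len belief_append nth_append bayes_def Z_def p_def)
  ultimately show ?case by (simp add: J del: state_obs_law.simps belief.simps)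
qed

text \<open>
  By exactness, the next observation given the history has the predictive law of the filter.
\<close>

lemma pmf_obs_law_Suc:
  assumes "length ys = k"
  shows "pmf (obs_law \<phi>p \<phi>o \<nu>0 \<theta> w a (Suc k)) (ys @ [y]) = pmf (obs_law \<phi>p \<phi>o \<nu>0 \<theta> w a k) ys *
    push (obs_prob \<phi>o w) (push (\<lambda>s. trans_prob \<phi>p \<theta> s (a k)) (belief \<phi>p \<phi>o \<nu>0 \<theta> w a ys k)) y"
  unfolding pmf_obs_law[of _ _ _ _ _ _ "Suc k"] pmf_state_obs_law_Suc[OF assms]
    pmf_state_obs_law_eq_belief[OF assms] push_def
  by (simp add: sum_distrib_left mult_ac)

lemma expectation_obs_law:
  "measure_pmf.expectation (obs_law \<phi>p \<phi>o \<nu>0 \<theta> w a k) f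
    = (\<Sum>ys | length ys = k. pmf (obs_law \<phi>p \<phi>o \<nu>0 \<theta> w a k) ys * f ys)" for f :: "'o::finite list \<Rightarrow> real"
  by (subst integral_measure_pmf[of "{ys. length ys = k}"])
    (auto simp: finite_lists_length obs_law_def dest: length_state_obs_law)

lemma expectation_obs_law_Suc:
  fixes f :: "'o::finite list \<Rightarrow> real"
  shows "measure_pmf.expectation (obs_law \<phi>p \<phi>o \<nu>0 \<theta> w a (Suc k)) f
    = (\<Sum>ys | length ys = k. pmf (obs_law \<phi>p \<phi>o \<nu>0 \<theta> w a k) ys * (\<Sum>y\<in>UNIV.
        push (obs_prob \<phi>o w) (push (\<lambda>s. trans_prob \<phi>p \<theta> s (a k)) (belief \<phi>p \<phi>o \<nu>0 \<theta> w a ys k)) y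
          * f (ys @ [y])))"
proof -
  let ?\<mu> = "obs_law \<phi>p \<phi>o \<nu>0 \<theta> w a (Suc k)"
  have lists: "{ys :: 'o list. length ys = Suc k} = (\<lambda>(ys, y). ys @ [y]) ` ({ys. length ys = k} \<times> UNIV)"
    by (auto simp: length_Suc_conv_rev)
  have "measure_pmf.expectation ?\<mu> f = (\<Sum>(ys, y)\<in>{ys. length ys = k} \<times> UNIV. pmf ?\<mu> (ys @ [y]) * f (ys @ [y]))"
    unfolding expectation_obs_law lists
    by (subst sum.reindex) (auto simp: inj_on_def case_prod_unfold)
  also have "\<dots> = (\<Sum>ys | length ys = k. \<Sum>y\<in>UNIV. pmf ?\<mu> (ys @ [y]) * f (ys @ [y]))"
    by (simp add: sum.cartesian_product)
  finally show ?thesis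
    by (simp add: pmf_obs_law_Suc sum_distrib_left mult.assoc)
qed

section \<open>The error recursion\<close>

lemma sum_pmf_obs_law: "(\<Sum>ys | length ys = k. pmf (obs_law \<phi>p \<phi>o \<nu>0 \<theta> w a k) ys) = 1"
  using expectation_obs_law[of \<phi>p \<phi>o \<nu>0 \<theta> w a k "\<lambda>_. 1"] by simp

definition belief_error ::
  "('s::finite, 'a, 'p::finite) trans_feature \<Rightarrow> ('s, 'o::finite, 'q::finite) obs_feature \<Rightarrow>
   's pmf \<Rightarrow> real ^ 'p \<Rightarrow> real ^ 'q \<Rightarrow> real ^ 'p \<Rightarrow> real ^ 'q \<Rightarrow> (nat \<Rightarrow> 'a) \<Rightarrow> nat \<Rightarrow> real" where
  "belief_error \<phi>p \<phi>o \<nu>0 \<theta> w \<theta>s ws a k =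
     measure_pmf.expectation (obs_law \<phi>p \<phi>o \<nu>0 \<theta>s ws a k)
       (\<lambda>ys. tv_dist (belief \<phi>p \<phi>o \<nu>0 \<theta> w a ys k) (belief \<phi>p \<phi>o \<nu>0 \<theta>s ws a ys k))"

text \<open>
  Averages the one-step bound over the history, with the generating parameter \<open>(\<theta>s, ws)\<close> in the
  primed position, since the observations follow its predictive law.
\<close>

lemma expected_belief_error_step:
  fixes \<phi>p :: "('s::finite, 'a, 'p::finite) trans_feature"
    and \<phi>o :: "('s, 'o::finite, 'q::finite) obs_feature"
  assumes "\<And>s act s'. norm (\<phi>p s act s') \<le> B" and "\<And>s y. norm (\<phi>o s y) \<le> B"
    and \<kappa>P: "\<And>s s' act. \<kappa>P \<le> (\<Sum>x\<in>UNIV. min (trans_prob \<phi>p \<theta> s act x) (trans_prob \<phi>p \<theta> s' act x))"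
    and \<kappa>Phi: "\<And>s s'. \<kappa>Phi \<le> (\<Sum>y\<in>UNIV. min (obs_prob \<phi>o ws s y) (obs_prob \<phi>o ws s' y))"
    and "\<kappa>Phi \<le> 1"
  shows "belief_error \<phi>p \<phi>o \<nu>0 \<theta> w \<theta>s ws a (Suc k) \<le> (2 - \<kappa>Phi)
    * ((1 - \<kappa>P) * belief_error \<phi>p \<phi>o \<nu>0 \<theta> w \<theta>s ws a k + B * norm (\<theta> - \<theta>s) / 2)
    + B * norm (w - ws)"
proof -
  let ?err = "belief_error \<phi>p \<phi>o \<nu>0 \<theta> w \<theta>s ws a"
  define m where "m = pmf (obs_law \<phi>p \<phi>o \<nu>0 \<theta>s ws a k)"
  let ?A = "{ys :: 'o list. length ys = k}"
  let ?b = "\<lambda>ys. belief \<phi>p \<phi>o \<nu>0 \<theta> w a ys k" and ?b' = "\<lambda>ys. belief \<phi>p \<phi>o \<nu>0 \<theta>s ws a ys k"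
  let ?K = "\<lambda>s. trans_prob \<phi>p \<theta> s (a k)" and ?K' = "\<lambda>s. trans_prob \<phi>p \<theta>s s (a k)"
  define c where "c = (2 - \<kappa>Phi) * (B * norm (\<theta> - \<theta>s) / 2) + B * norm (w - ws)"
  define g where "g = (2 - \<kappa>Phi) * (1 - \<kappa>P)"
  have "?err (Suc k) = (\<Sum>ys\<in>?A. m ys * (\<Sum>y\<in>UNIV. push (obs_prob \<phi>o ws) (push ?K' (?b' ys)) y *
      tv_dist (bayes (\<lambda>s. obs_prob \<phi>o w s y) (push ?K (?b ys)))
        (bayes (\<lambda>s. obs_prob \<phi>o ws s y) (push ?K' (?b' ys)))))"
    unfolding belief_error_def expectation_obs_law_Suc m_def belief_Suc_eq_bayes_push
    by (intro sum.cong refl) (simp add: belief_append nth_append)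
  also have "\<dots> \<le> (\<Sum>ys\<in>?A. m ys * (g * tv_dist (?b ys) (?b' ys) + c))"
  proof (intro sum_mono mult_left_mono)
    fix ys :: "'o list"
    show "(\<Sum>y\<in>UNIV. push (obs_prob \<phi>o ws) (push ?K' (?b' ys)) y *
      tv_dist (bayes (\<lambda>s. obs_prob \<phi>o w s y) (push ?K (?b ys)))
        (bayes (\<lambda>s. obs_prob \<phi>o ws s y) (push ?K' (?b' ys)))) \<le> g * tv_dist (?b ys) (?b' ys) + c"
      using expected_tv_dist_filter_step[of ?K ?K' "obs_prob \<phi>o w" "obs_prob \<phi>o ws" \<kappa>P \<kappa>Phi
          "B * norm (\<theta> - \<theta>s) / 2" "2 * (B * norm (w - ws))" "?b ys" "?b' ys",
          OF prob_vec_trans_prob prob_vec_trans_prob obs_prob_pos prob_vec_obs_prob obs_prob_pos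
            \<kappa>P \<kappa>Phi \<open>\<kappa>Phi \<le> 1\<close> tv_dist_trans_prob[OF assms(1)] abs_ln_obs_prob_ratio[OF assms(2)]
            prob_vec_belief prob_vec_belief]
      by (simp add: g_def c_def algebra_simps)
  qed (simp add: m_def)
  also have "\<dots> = g * (\<Sum>ys\<in>?A. m ys * tv_dist (?b ys) (?b' ys)) + sum m ?A * c"
    by (simp add: distrib_left sum.distrib sum_distrib_left sum_distrib_right mult_ac)
  also have "\<dots> = g * ?err k + c"
    by (simp add: belief_error_def expectation_obs_law m_def sum_pmf_obs_law)
  finally show ?thesis by (simp add: g_def c_def algebra_simps)
qed

lemma affine_recursion_bound:
  fixes e :: "nat \<Rightarrow> real"
  assumes "e 0 = 0" "\<And>k. e (Suc k) \<le> \<alpha> * e k + c" "0 \<le> \<alpha>" "\<alpha> < 1"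
  shows "e t \<le> (1 - \<alpha> ^ t) / (1 - \<alpha>) * c"
proof (induction t)
  case 0
  then show ?case using assms by simp
next
  case (Suc t)
  have "e (Suc t) \<le> \<alpha> * e t + c" by (rule assms)
  also have "\<dots> \<le> \<alpha> * ((1 - \<alpha> ^ t) / (1 - \<alpha>) * c) + c"
    using Suc assms(3) by (intro add_right_mono mult_left_mono)
  also have "\<dots> = (1 - \<alpha> ^ Suc t) / (1 - \<alpha>) * c"
    using assms(4) by (simp add: field_simps)
  finally show ?case .
qed

theorem theorem4p1:
  fixes \<phi>p :: "('s::finite, 'a::finite, 'p::finite) trans_feature"
    and \<phi>o :: "('s, 'o::finite, 'q::finite) obs_feature"
    and \<nu>0 :: "'s pmf"
    and \<theta> \<theta>s :: "real ^ 'p"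
    and w ws :: "real ^ 'q"
    and a :: "nat \<Rightarrow> 'a"
    and t :: nat
    and B r \<nu>min \<nu>max \<kappa>P \<kappa>Phi \<alpha> :: real
  assumes "\<And>s act s'. norm (\<phi>p s act s') \<le> B"
    and "\<And>s y. norm (\<phi>o s y) \<le> B"
    and "0 < \<nu>min" and "\<nu>max < 1"
    and "\<And>s. \<nu>min \<le> pmf \<nu>0 s" and "\<And>s. pmf \<nu>0 s \<le> \<nu>max"
    and "r > 0"
    and "\<kappa>P = kappa_P \<phi>p (feasible \<theta>s ws r)"
    and "\<kappa>Phi = kappa_Phi \<phi>o (feasible \<theta>s ws r)"
    and "0 < \<kappa>P" and "\<kappa>P \<le> 1"
    and "0 < \<kappa>Phi" and "\<kappa>Phi \<le> 1"
    and "\<alpha> = (1 - \<kappa>P) * (4 - 3 * \<kappa>Phi)"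
    and "\<alpha> < 1"
    and "(\<theta>, w) \<in> feasible \<theta>s ws r"
    and "t \<ge> 1"
  shows "measure_pmf.expectation (obs_law \<phi>p \<phi>o \<nu>0 \<theta>s ws a t)
           (\<lambda>ys. tv_dist (belief \<phi>p \<phi>o \<nu>0 \<theta> w a ys t) (belief \<phi>p \<phi>o \<nu>0 \<theta>s ws a ys t))
         \<le> (1 - \<alpha> ^ t) / (1 - \<alpha>) * c_b B \<kappa>Phi (norm (\<theta> - \<theta>s)) (norm (w - ws))"
proof -
  let ?err = "belief_error \<phi>p \<phi>o \<nu>0 \<theta> w \<theta>s ws a"
  have "0 \<le> B"
    using assms(2) norm_ge_zero order.trans by blast
  have true_feasible: "(\<theta>s, ws) \<in> feasible \<theta>s ws r"
    using \<open>r > 0\<close> by (simp add: feasible_def)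
  have "?err t \<le> (1 - \<alpha> ^ t) / (1 - \<alpha>) * c_b B \<kappa>Phi (norm (\<theta> - \<theta>s)) (norm (w - ws))"
  proof (rule affine_recursion_bound)
    show "?err 0 = 0" by (simp add: belief_error_def tv_dist_def)
    show "0 \<le> \<alpha>" "\<alpha> < 1" using assms(11,13-15) by auto
    fix k
    have "0 \<le> ?err k"
      unfolding belief_error_def by (simp add: tv_dist_nonneg)
    have "?err (Suc k) \<le> (2 - \<kappa>Phi) * ((1 - \<kappa>P) * ?err k + B * norm (\<theta> - \<theta>s) / 2) + B * norm (w - ws)"
      using assms(1,2) \<open>\<kappa>Phi \<le> 1\<close>
      by (intro expected_belief_error_step)
        (auto simp: assms(8,9) intro: kappa_P_le[OF assms(16)] kappa_Phi_le[OF true_feasible])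
    also have "\<dots> = (2 - \<kappa>Phi) * ((1 - \<kappa>P) * ?err k) + (2 - \<kappa>Phi) * (B * norm (\<theta> - \<theta>s) / 2) + B * norm (w - ws)"
      by (simp add: algebra_simps)
    \<comment> \<open>\<open>2 - \<kappa>Phi \<le> 3 - 2 \<kappa>Phi \<le> 4 - 3 \<kappa>Phi\<close>\<close>
    also have "\<dots> \<le> (4 - 3 * \<kappa>Phi) * ((1 - \<kappa>P) * ?err k)
        + (3 - 2 * \<kappa>Phi) * (B * norm (\<theta> - \<theta>s) / 2) + B * norm (w - ws)"
      using \<open>\<kappa>P \<le> 1\<close> \<open>\<kappa>Phi \<le> 1\<close> \<open>0 \<le> ?err k\<close> \<open>0 \<le> B\<close>
      by (intro add_right_mono add_mono mult_right_mono) auto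
    also have "\<dots> = \<alpha> * ?err k + c_b B \<kappa>Phi (norm (\<theta> - \<theta>s)) (norm (w - ws))"
      by (simp add: assms(14) c_b_def algebra_simps)
    finally show "?err (Suc k) \<le> \<alpha> * ?err k + c_b B \<kappa>Phi (norm (\<theta> - \<theta>s)) (norm (w - ws))" .
  qed
  then show ?thesis by (simp add: belief_error_def)
qed

end
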